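(* In every orthomodular lattice $L$ the identity $$(x+_l y)+_l y=x$$ holds for all $x,y\in L$.
   Context: An orthomodular lattice (OML) is an algebra $(L,\lor,\land,',0,1)$ such that $(L,\lor,\land,0,1)$ is a bounded lattice, $'$ is an orthocomplementation ($x\land x'=0$, $x\lor x'=1$, $x''=x$, and $x\le y$ implies $y'\le x'$), and the orthomodular law holds: $x\le y$ implies $y=x\lor(y\land x')$. The operation $+_l$ is defined by $x+_l y:=(x\lor(x'\land y))\land(x'\lor y')$. *)

theory Defs
  imports "HOL-Library.Complemented_Lattices"
begin

text \<open>
  The orthocomplement of \<open>x\<close> is \<open>- x\<close> in the class \<^class>\<open>orthomodular_lattice\<close>.
  The binary minus of that class is determined by the axiom \<open>x - y = x \<sqinter> - y\<close>, so it
  carries no additional structure.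
\<close>

context orthomodular_lattice
begin

context
  includes lattice_syntax
begin

definition plus_l :: "'a \<Rightarrow> 'a \<Rightarrow> 'a"  (infixl "+\<^sub>l" 65)
  where "x +\<^sub>l y = (x \<squnion> (- x \<sqinter> y)) \<sqinter> (- x \<squnion> - y)"

end

end

end

theory Submission
  imports Defs
begin

text \<open>
  Since \<open>x +\<^sub>l y\<close> is an orthogonal join of \<open>r = x \<sqinter> - (x \<sqinter> y)\<close>, the part of \<open>x\<close> outside
  \<open>x \<sqinter> y\<close>, and \<open>a = - x \<sqinter> y\<close> (lemma \<open>plus_l_eq_sup\<close>), adding \<open>y\<close> a second time is governed
  by the two meets \<open>z \<sqinter> y\<close> and \<open>- z \<sqinter> y\<close> of \<open>z = r \<squnion> a\<close>. By orthomodularity these are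
  \<open>a\<close> and \<open>x \<sqinter> y\<close>: adding \<open>y\<close> exchanges the meets of \<open>y\<close> with \<open>x\<close> and with \<open>- x\<close>
  (lemmas \<open>plus_l_inf\<close> and \<open>compl_plus_l_inf\<close>) and keeps \<open>r\<close>. The second addition therefore
  removes \<open>a\<close> from \<open>z\<close> and restores \<open>x \<sqinter> y\<close>, leaving \<open>r \<squnion> (x \<sqinter> y) = x\<close>.

  Distributivity being unavailable, every rearrangement is an instance of the orthomodular law
  or of its dual form \<open>sup_inf_compl_cancel\<close>, by which an orthogonal summand of a join can be
  cut off again.
\<close>

context orthomodular_lattice
begin

context
  includes lattice_syntax
begin

lemma sup_inf_compl_cancel:
  assumes "c \<le> - b"
  shows "(c \<squnion> b) \<sqinter> - b = c"
proof -
  have "b \<le> - c"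
    using assms compl_le_swap1 by blast
  then have "b \<squnion> (- b \<sqinter> - c) = - c"
    by (rule orthomodular)
  then have "- (b \<squnion> (- b \<sqinter> - c)) = c"
    by simp
  then show ?thesis
    by (simp add: ac_simps)
qed

text \<open>
  An element lying above \<open>p\<close> and having zero meet with \<open>- p\<close> equals \<open>p\<close>. This is how the
  orthomodular law is used to compute meets that a distributive law would give in a
  Boolean algebra.
\<close>

lemma eq_of_le_inf_compl_bot:
  assumes "p \<le> q" and "q \<sqinter> - p = \<bottom>"
  shows "q = p"
  using orthomodular[OF assms(1)] assms(2) by (simp add: ac_simps)

text \<open>
  The element \<open>x \<sqinter> y\<close> is orthogonal to both terms on the right, and its join with them is
  \<open>x \<squnion> (- x \<sqinter> y)\<close>; meeting with \<open>- x \<squnion> - y = - (x \<sqinter> y)\<close> cuts it off.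
\<close>

lemma plus_l_eq_sup: "x +\<^sub>l y = (x \<sqinter> - (x \<sqinter> y)) \<squnion> (- x \<sqinter> y)"
proof -
  define b where "b = x \<sqinter> y"
  define c where "c = (x \<sqinter> - b) \<squnion> (- x \<sqinter> y)"
  have "b \<le> x"
    by (simp add: b_def)
  have "- x \<sqinter> y \<le> - b"
    using \<open>b \<le> x\<close> by (meson compl_mono inf.coboundedI1)
  then have "c \<le> - b"
    by (simp add: c_def)
  moreover have "x \<squnion> (- x \<sqinter> y) = c \<squnion> b"
    using orthomodular[OF \<open>b \<le> x\<close>] unfolding c_def by (metis inf.commute sup.assoc sup.commute)
  ultimately have "(x \<squnion> (- x \<sqinter> y)) \<sqinter> - b = c"
    by (simp add: sup_inf_compl_cancel)
  then show ?thesis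
    by (simp add: plus_l_def b_def c_def)
qed

text \<open>
  The summands in \<open>plus_l_eq_sup\<close> are orthogonal, one lying below \<open>x\<close> and the other below
  \<open>- x\<close>, so either can be cut off from the join.
\<close>

lemma plus_l_inf_compl: "(x +\<^sub>l y) \<sqinter> - (- x \<sqinter> y) = x \<sqinter> - (x \<sqinter> y)"
proof -
  have "x \<sqinter> - (x \<sqinter> y) \<le> - (- x \<sqinter> y)"
    by (simp add: le_infI1)
  then show ?thesis
    unfolding plus_l_eq_sup by (rule sup_inf_compl_cancel)
qed

lemma plus_l_inf: "(x +\<^sub>l y) \<sqinter> y = - x \<sqinter> y"
proof (rule eq_of_le_inf_compl_bot)
  show "- x \<sqinter> y \<le> (x +\<^sub>l y) \<sqinter> y"
    by (simp add: plus_l_eq_sup)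
  have "((x +\<^sub>l y) \<sqinter> y) \<sqinter> - (- x \<sqinter> y) = ((x +\<^sub>l y) \<sqinter> - (- x \<sqinter> y)) \<sqinter> y"
    by (simp only: ac_simps)
  also have "\<dots> = (x \<sqinter> y) \<sqinter> - (x \<sqinter> y)"
    unfolding plus_l_inf_compl by (simp only: ac_simps)
  also have "\<dots> = \<bottom>"
    by (rule inf_compl_bot)
  finally show "((x +\<^sub>l y) \<sqinter> y) \<sqinter> - (- x \<sqinter> y) = \<bottom>" .
qed

lemma compl_plus_l_inf: "- (x +\<^sub>l y) \<sqinter> y = x \<sqinter> y"
proof (rule eq_of_le_inf_compl_bot)
  have "x +\<^sub>l y \<le> - (x \<sqinter> y)"
    by (simp add: plus_l_def)
  then show "x \<sqinter> y \<le> - (x +\<^sub>l y) \<sqinter> y"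
    using compl_le_swap1 by simp
  have compl: "- (x +\<^sub>l y) = (- x \<squnion> (x \<sqinter> y)) \<sqinter> - (- x \<sqinter> y)"
    by (simp add: plus_l_eq_sup)
  have "- x \<le> - (x \<sqinter> y)"
    by simp
  then have cut: "(- x \<squnion> (x \<sqinter> y)) \<sqinter> - (x \<sqinter> y) = - x"
    by (rule sup_inf_compl_cancel)
  have "(- (x +\<^sub>l y) \<sqinter> y) \<sqinter> - (x \<sqinter> y)
      = (((- x \<squnion> (x \<sqinter> y)) \<sqinter> - (x \<sqinter> y)) \<sqinter> y) \<sqinter> - (- x \<sqinter> y)"
    unfolding compl by (simp only: ac_simps)
  also have "\<dots> = \<bottom>"
    unfolding cut by (rule inf_compl_bot)
  finally show "(- (x +\<^sub>l y) \<sqinter> y) \<sqinter> - (x \<sqinter> y) = \<bottom>" .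
qed

lemma plus_l_plus_l_cancel: "(x +\<^sub>l y) +\<^sub>l y = x"
proof -
  have "(x +\<^sub>l y) +\<^sub>l y
      = ((x +\<^sub>l y) \<sqinter> - ((x +\<^sub>l y) \<sqinter> y)) \<squnion> (- (x +\<^sub>l y) \<sqinter> y)"
    by (rule plus_l_eq_sup)
  also have "\<dots> = (x \<sqinter> - (x \<sqinter> y)) \<squnion> (x \<sqinter> y)"
    by (simp only: plus_l_inf compl_plus_l_inf plus_l_inf_compl)
  also have "\<dots> = x"
    using orthomodular[of "x \<sqinter> y" x] by (simp add: ac_simps)
  finally show ?thesis .
qed

end

end

theorem theorem7:
  fixes x y :: "'a :: orthomodular_lattice"
  shows "(x +\<^sub>l y) +\<^sub>l y = x"
  by (rule plus_l_plus_l_cancel)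

end
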